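(* Let $n\geq 2$ and let $BH_n$ be the $n$-dimensional balanced hypercube with bipartition $(V_0,V_1)$. Let $S=\{s_1,\dots,s_{2n-2}\}\subseteq V_0$ and $T=\{t_1,\dots,t_{2n-2}\}\subseteq V_1$ be sets of $2n-2$ distinct vertices each. Then there exist a permutation $\psi$ of $\{1,\dots,2n-2\}$ and pairwise vertex-disjoint paths $P_1,\dots,P_{2n-2}$ in $BH_n$ such that $P_i$ joins $s_i$ to $t_{\psi(i)}$ for each $i$ and $V(P_1)\cup\dots\cup V(P_{2n-2})=V(BH_n)$ (i.e., $BH_n$ has an unpaired $(2n-2)$-disjoint path cover joining $S$ and $T$).
   Context: The $n$-dimensional balanced hypercube $BH_n$ ($n\ge 1$) has vertex set $\{(a_0,a_1,\dots,a_{n-1}) : a_i\in\{0,1,2,3\}\}$ ($4^n$ vertices). A vertex $v=(a_0,\dots,a_{n-1})$ is adjacent to exactly the following $2n$ vertices: $((a_0\pm 1)\bmod 4, a_1,\dots,a_{n-1})$, and, for each $1\le i\le n-1$, $((a_0\pm1)\bmod 4, a_1,\dots,a_{i-1},(a_i+(-1)^{a_0})\bmod 4,a_{i+1},\dots,a_{n-1})$. $BH_n$ is bipartite with bipartition $V_0$ (vertices with even first coordinate $a_0$) and $V_1$ (vertices with odd first coordinate $a_0$). *)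

theory Defs
  imports Main
begin

definition bh_vertices :: "nat \<Rightarrow> nat list set" where
  "bh_vertices n = {v. length v = n \<and> (\<forall>i<n. v ! i < 4)}"

definition bh_adj :: "nat \<Rightarrow> nat list \<Rightarrow> nat list \<Rightarrow> bool" where
  "bh_adj n u v \<longleftrightarrow> u \<in> bh_vertices n \<and> v \<in> bh_vertices n \<and>
     (\<exists>d\<in>{1::int, -1}.
        (v = u[0 := nat ((int (u ! 0) + d) mod 4)]) \<or>
        (\<exists>i. 1 \<le> i \<and> i < n \<and>
           v = u[0 := nat ((int (u ! 0) + d) mod 4),
                 i := nat ((int (u ! i) + (-1) ^ (u ! 0)) mod 4)]))"

definition bh_V0 :: "nat \<Rightarrow> nat list set" where
  "bh_V0 n = {v \<in> bh_vertices n. even (v ! 0)}"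

definition bh_V1 :: "nat \<Rightarrow> nat list set" where
  "bh_V1 n = {v \<in> bh_vertices n. odd (v ! 0)}"

definition bh_path :: "nat \<Rightarrow> nat list list \<Rightarrow> bool" where
  "bh_path n P \<longleftrightarrow> P \<noteq> [] \<and> distinct P \<and> set P \<subseteq> bh_vertices n \<and>
     (\<forall>j. Suc j < length P \<longrightarrow> bh_adj n (P ! j) (P ! Suc j))"

end

theory Submission
  imports Defs
begin

text \<open>
  Vertices that differ by 2 in the first coordinate are twins: they have the same neighbours. With
  \<open>n = m + 1\<close>, identifying twins turns the graph into a bipartite graph on two copies of \<open>\<int>\<^sub>4\<^sup>m\<close> in which an
  even \<open>x\<close> is joined to the odd \<open>x, x + e\<^sub>1, \<dots>, x + e\<^sub>m\<close>.

  A path cover joining \<open>S\<close> to \<open>T\<close> is a perfect matching \<open>f\<close> of the whole graph together with a perfect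
  matching of the graph without \<open>S \<union> T\<close> whose union is acyclic. The second matching exists by
  Hall's theorem, because a set \<open>Y\<close> of points has at least \<open>|Y| + m\<close> neighbours unless it dominates
  everything. Complete it by an arbitrary bijection from \<open>T\<close> to \<open>S\<close> to a bijection \<open>g\<close> from the odd to the
  even vertices. Exchanging the \<open>f\<close>-partners of two even vertices which are twins, or whose partners are
  twins, keeps \<open>f\<close> a matching; if the two lie on different cycles of \<open>g \<circ> f\<close>, these cycles merge. If the
  projection of \<open>f\<close> to the quotient is a Hamiltonian cycle, such exchanges are available until
  \<open>g \<circ> f\<close> is a single cycle, and removing the pairs from \<open>T\<close> to \<open>S\<close> cuts it into the desired paths.
\<close>

section \<open>Hall's theorem\<close>

text \<open>Induction on the number of indices. If every proper nonempty subfamily has a surplus,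
  any choice for one index keeps the condition; otherwise a tight subfamily is matched inside its
  own union and the rest outside it.\<close>

theorem hall_marriage:
  assumes "finite I" and "\<And>i. i \<in> I \<Longrightarrow> finite (F i)"
    and "\<And>J. J \<subseteq> I \<Longrightarrow> card J \<le> card (\<Union>(F ` J))"
  shows "\<exists>r. inj_on r I \<and> (\<forall>i\<in>I. r i \<in> F i)"
  using assms
proof (induction "card I" arbitrary: I F rule: less_induct)
  case less
  note fin = less.prems(1) and finF = less.prems(2) and H = less.prems(3)
  have finU: "finite (\<Union>(F ` J))" if "J \<subseteq> I" for J
    using that fin finF by (meson finite_UN finite_subset subsetD)
  consider "I = {}"
    | (slack) "I \<noteq> {}" "\<And>J. J \<subset> I \<Longrightarrow> J \<noteq> {} \<Longrightarrow> card J < card (\<Union>(F ` J))"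
    | (tight) J where "J \<subset> I" "J \<noteq> {}" "card (\<Union>(F ` J)) = card J"
    using H by (metis le_neq_implies_less psubset_imp_subset)
  then show ?case
  proof cases
    case 1
    then show ?thesis by simp
  next
    case slack
    then obtain i where i: "i \<in> I" by blast
    have "card {i} \<le> card (\<Union>(F ` {i}))" using H i by (metis bot.extremum insert_subset)
    then obtain x where x: "x \<in> F i" by fastforce
    have "\<exists>r. inj_on r (I - {i}) \<and> (\<forall>j\<in>I - {i}. r j \<in> F j - {x})"
    proof (rule less.hyps)
      show "card (I - {i}) < card I" using i fin by (meson card_Diff1_less)
      fix J assume J: "J \<subseteq> I - {i}"
      show "card J \<le> card (\<Union>j\<in>J. F j - {x})"
      proof (cases "J = {}")
        case False
        have eq: "(\<Union>j\<in>J. F j - {x}) = \<Union>(F ` J) - {x}" by blast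
        have "card J < card (\<Union>(F ` J))" using slack(2)[of J] J i False by blast
        then show ?thesis unfolding eq
          using diff_card_le_card_Diff[of "{x}" "\<Union>(F ` J)"] by simp
      qed simp
    qed (use fin finF in auto)
    then obtain r where r: "inj_on r (I - {i})" "\<forall>j\<in>I - {i}. r j \<in> F j - {x}" by blast
    have "inj_on (r(i := x)) I" using r i by (auto simp: inj_on_def)
    then show ?thesis using r x by (intro exI[of _ "r(i := x)"]) auto
  next
    case tight
    have finJ: "finite J" and JI: "J \<subseteq> I" using tight fin finite_subset by blast+
    have "\<exists>r. inj_on r J \<and> (\<forall>j\<in>J. r j \<in> F j)"
      by (rule less.hyps) (use tight fin finF H finJ in \<open>auto intro: psubset_card_mono\<close>)
    then obtain r where r: "inj_on r J" "\<forall>j\<in>J. r j \<in> F j" by blast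
    let ?U = "\<Union>(F ` J)"
    have "\<exists>q. inj_on q (I - J) \<and> (\<forall>j\<in>I - J. q j \<in> F j - ?U)"
    proof (rule less.hyps)
      show "card (I - J) < card I" using tight fin
        by (intro psubset_card_mono) auto
      fix K assume K: "K \<subseteq> I - J"
      \<comment> \<open>Hall's condition for \<open>K \<union> J\<close>, minus the union
        \<open>?U\<close> that \<open>J\<close> uses up exactly, leaves the condition for
        \<open>K\<close>.\<close>
      have "card K + card J = card (K \<union> J)"
        using K finJ fin by (subst card_Un_disjoint) (auto intro: finite_subset)
      also have "\<dots> \<le> card (\<Union>(F ` (K \<union> J)))" by (rule H) (use K JI in auto)
      also have "\<Union>(F ` (K \<union> J)) = (\<Union>j\<in>K. F j - ?U) \<union> ?U" by blast
      also have "card \<dots> = card (\<Union>j\<in>K. F j - ?U) + card ?U"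
        using finU[of K] finU[of J] K JI
        by (intro card_Un_disjoint) (auto intro: finite_subset[of _ "\<Union>(F ` K)"])
      finally show "card K \<le> card (\<Union>j\<in>K. F j - ?U)" using tight by simp
    qed (use fin finF in auto)
    then obtain q where q: "inj_on q (I - J)" "\<forall>j\<in>I - J. q j \<in> F j - ?U" by blast
    let ?c = "\<lambda>j. if j \<in> J then r j else q j"
    have cross: "r x \<noteq> q y" if "x \<in> J" "y \<in> I - J" for x y
      using r(2) q(2) that by (metis DiffD2 UN_I)
    have "inj_on ?c I"
    proof (rule inj_onI)
      fix x y assume xy: "x \<in> I" "y \<in> I" "?c x = ?c y"
      show "x = y"
      proof (cases "x \<in> J"; cases "y \<in> J")
        assume "x \<in> J" "y \<in> J"
        then show ?thesis using xy r(1) by (simp add: inj_onD)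
      next
        assume "x \<notin> J" "y \<notin> J"
        then show ?thesis using xy q(1) by (simp add: inj_onD)
      next
        assume "x \<in> J" "y \<notin> J"
        then show ?thesis using xy cross[of x y] by simp
      next
        assume "x \<notin> J" "y \<in> J"
        then show ?thesis using xy cross[of y x] by simp
      qed
    qed
    moreover have "\<forall>j\<in>I. ?c j \<in> F j" using r q by auto
    ultimately show ?thesis by blast
  qed
qed

section \<open>Merging the cycles of a permutation\<close>

text \<open>For a permutation \<open>h\<close> of a finite \<open>A\<close> this is the cycle
  through \<open>s\<close>. As a least invariant set it needs no counting of iterations; the outer
  \<open>A\<close> keeps it inside \<open>A\<close> even when no candidate \<open>X\<close>
  exists.\<close>

definition orb :: "'a set \<Rightarrow> ('a \<Rightarrow> 'a) \<Rightarrow> 'a \<Rightarrow> 'a set" where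
  "orb A h s = A \<inter> \<Inter>{X. X \<subseteq> A \<and> s \<in> X \<and> h ` X \<subseteq> X}"

lemma orb_least: "X \<subseteq> A \<Longrightarrow> s \<in> X \<Longrightarrow> h ` X \<subseteq> X \<Longrightarrow> orb A h s \<subseteq> X"
  unfolding orb_def by blast

lemma orb_props:
  assumes "s \<in> A" "h ` A \<subseteq> A"
  shows "orb A h s \<subseteq> A" "s \<in> orb A h s" "h ` orb A h s \<subseteq> orb A h s"
  using assms unfolding orb_def by blast+

text \<open>An injection of a finite set into itself is onto, so no point of \<open>A\<close>
  outside \<open>X\<close> can enter \<open>X\<close>.\<close>

lemma invariant_set_backward:
  assumes "finite A" "inj_on h A" "X \<subseteq> A" "h ` X \<subseteq> X" "x \<in> A" "h x \<in> X"
  shows "x \<in> X"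
proof -
  have "h ` X = X"
    using assms by (meson card_image card_subset_eq finite_subset inj_on_subset)
  then obtain y where "y \<in> X" "h y = h x" using assms(6) by (metis imageE)
  then show ?thesis using assms by (metis inj_onD subsetD)
qed

text \<open>Exchanging the images of points on two different cycles joins these cycles. Only the
  strict growth of the one through \<open>s\<close> is recorded.\<close>

lemma orb_grows_by_swap:
  assumes fin: "finite A" and bij: "bij_betw h A A" and s: "s \<in> A"
    and a: "a \<in> orb A h s" and a': "a' \<in> A" "a' \<notin> orb A h s"
  shows "orb A h s \<subset> orb A (h(a := h a', a' := h a)) s"
proof -
  define h' where "h' = h(a := h a', a' := h a)"
  define R where "R = orb A h s"
  define R' where "R' = orb A h' s"
  have inj: "inj_on h A" and hA: "h ` A \<subseteq> A" using bij by (auto simp: bij_betw_def)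
  have R: "R \<subseteq> A" "s \<in> R" "h ` R \<subseteq> R"
    unfolding R_def using orb_props[of s A h] s hA by blast+
  have aR: "a \<in> R" "a \<in> A" "a' \<notin> R" using a a' R by (auto simp: R_def)
  have h'A: "h' ` A \<subseteq> A" using hA aR a' by (auto simp: h'_def)
  have R': "R' \<subseteq> A" "s \<in> R'" "h' ` R' \<subseteq> R'"
    unfolding R'_def using orb_props[of s A h'] s h'A by blast+
  have least: "R \<subseteq> X" if "X \<subseteq> A" "s \<in> X" "h ` X \<subseteq> X" for X
    using orb_least that unfolding R_def by metis
  have ne: "a \<noteq> a'" using aR by auto
  have same: "h' x = h x" if "x \<noteq> a" "x \<noteq> a'" for x using that by (simp add: h'_def)
  have h'a: "h' a = h a'" "h' a' = h a" using ne by (auto simp: h'_def)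
  \<comment> \<open>Otherwise \<open>h'\<close> agrees with \<open>h\<close> on
    \<open>R' \<inter> R\<close>, an \<open>h\<close>-invariant set containing \<open>s\<close> but
    not \<open>a\<close>, against the minimality of \<open>R\<close>.\<close>
  have "a \<in> R'"
  proof (rule ccontr)
    assume n: "a \<notin> R'"
    have "h ` (R' \<inter> R) \<subseteq> R' \<inter> R"
    proof
      fix y assume "y \<in> h ` (R' \<inter> R)"
      then obtain x where x: "x \<in> R'" "x \<in> R" "y = h x" by blast
      then have "y = h' x" using same n aR by metis
      then show "y \<in> R' \<inter> R" using x R R' by blast
    qed
    then have "R \<subseteq> R' \<inter> R" using R R' by (intro least) auto
    then show False using n aR by blast
  qed
  \<comment> \<open>Otherwise \<open>R' - R\<close> is \<open>h\<close>-invariant and contains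
    \<open>h a' = h' a\<close>; going backwards along \<open>h\<close>, it contains
    \<open>a'\<close>.\<close>
  moreover have "a' \<in> R'"
  proof (rule ccontr)
    assume n: "a' \<notin> R'"
    let ?X = "R' - R"
    have bwd: "h x \<notin> R" if "x \<in> A" "x \<notin> R" for x
      using invariant_set_backward[OF fin inj R(1,3)] that by blast
    have "h ` ?X \<subseteq> ?X"
    proof
      fix y assume "y \<in> h ` ?X"
      then obtain x where x: "x \<in> R'" "x \<notin> R" "y = h x" by blast
      then have "y = h' x" using same n aR by metis
      then have "y \<in> R'" using x(1) R'(3) by blast
      moreover have "y \<notin> R" using x R'(1) bwd by blast
      ultimately show "y \<in> ?X" by blast
    qed
    moreover have "h a' \<in> ?X"
      using \<open>a \<in> R'\<close> R'(3) h'a(1) bwd[OF a'(1) aR(3)] by (metis DiffI image_subset_iff)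
    ultimately have "a' \<in> ?X"
      using invariant_set_backward[OF fin inj, of ?X a'] R' a' by blast
    then show False using n by blast
  qed
  moreover have "h ` R' \<subseteq> R'"
  proof
    fix y assume "y \<in> h ` R'"
    then obtain x where x: "x \<in> R'" "y = h x" by blast
    then have "y = h' x \<or> y = h' a \<or> y = h' a'" using same h'a by metis
    then show "y \<in> R'" using x(1) R'(3) calculation by auto
  qed
  ultimately show ?thesis
    using least[of R'] R' aR unfolding R_def R'_def h'_def by blast
qed

text \<open>Here \<open>p\<close> is the projection to the quotient and \<open>E\<close> its
  adjacency. While the cycle through \<open>s\<close> is not all of \<open>A\<close>, connectivity
  supplies a linked pair with one point inside and one outside, and exchanging their partners
  enlarges the cycle.\<close>

lemma single_orbit_by_twin_swaps:
  fixes p :: "'v \<Rightarrow> 'k"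
  assumes fin: "finite A" and f0: "bij_betw f0 A B" "\<forall>a\<in>A. E (p a) (p (f0 a))"
    and conn: "\<And>X. X \<subseteq> A \<Longrightarrow> X \<noteq> {} \<Longrightarrow>
      (\<forall>a\<in>X. \<forall>a'\<in>A. p a = p a' \<or> p (f0 a) = p (f0 a') \<longrightarrow> a' \<in> X) \<Longrightarrow> X = A"
    and g: "bij_betw g B A" and s: "s \<in> A"
  shows "\<exists>f. bij_betw f A B \<and> (\<forall>a\<in>A. E (p a) (p (f a))) \<and> orb A (g \<circ> f) s = A"
proof -
  define closed where "closed f X \<longleftrightarrow>
      (\<forall>a\<in>X. \<forall>a'\<in>A. p a = p a' \<or> p (f a) = p (f a') \<longrightarrow> a' \<in> X)" for f :: "'v \<Rightarrow> 'v" and X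
  \<comment> \<open>Connectivity belongs to the invariant, since it must survive every
    exchange.\<close>
  define good where "good f \<longleftrightarrow> bij_betw f A B \<and> (\<forall>a\<in>A. E (p a) (p (f a))) \<and>
      (\<forall>X. X \<subseteq> A \<longrightarrow> X \<noteq> {} \<longrightarrow> closed f X \<longrightarrow> X = A)" for f
  have bij_h: "bij_betw (g \<circ> f) A A" if "good f" for f
    using that bij_betw_trans[OF _ g] unfolding good_def by auto
  have orbA: "orb A h s \<subseteq> A" for h by (auto simp: orb_def)
  have "good f0" unfolding good_def closed_def by (intro conjI allI impI f0 conn)
  moreover have "card (orb A h s) < Suc (card A)" for h
    using card_mono[OF fin orbA] by (simp add: less_Suc_eq_le)
  \<comment> \<open>Among the good matchings, one with the longest cycle through \<open>s\<close> is
    taken.\<close>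
  ultimately have "\<exists>f. good f \<and> (\<forall>f'. good f' \<longrightarrow> card (orb A (g \<circ> f') s) \<le> card (orb A (g \<circ> f) s))"
    by (intro ex_has_greatest_nat[where k = f0 and b = "Suc (card A)"]) auto
  then obtain f where f: "good f"
    and max: "\<And>f'. good f' \<Longrightarrow> card (orb A (g \<circ> f') s) \<le> card (orb A (g \<circ> f) s)" by blast
  let ?R = "orb A (g \<circ> f) s"
  have R: "?R \<subseteq> A" "s \<in> ?R" using orb_props[of s A "g \<circ> f"] s bij_h[OF f]
    by (auto simp: bij_betw_def)
  have "closed f ?R"
  proof (rule ccontr)
    assume "\<not> closed f ?R"
    then obtain a a' where a: "a \<in> ?R" and a': "a' \<in> A" "a' \<notin> ?R"
      and tw: "p a = p a' \<or> p (f a) = p (f a')" unfolding closed_def by blast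
    have aA: "a \<in> A" using a R by blast
    define f' where "f' = f(a := f a', a' := f a)"
    have ne: "a \<noteq> a'" using a a' by auto
    have f'a: "f' a = f a'" "f' a' = f a" using ne by (auto simp: f'_def)
    have "f' = f \<circ> (id(a := a', a' := a))" by (auto simp: f'_def)
    moreover have "bij_betw (id(a := a', a' := a)) A A"
      by (rule bij_betw_byWitness[where f' = "id(a := a', a' := a)"]) (use aA a' in auto)
    ultimately have bij: "bij_betw f' A B" using f bij_betw_trans unfolding good_def by metis
    have "E (p x) (p (f' x))" if "x \<in> A" for x
    proof -
      have E: "E (p a) (p (f a))" "E (p a') (p (f a'))" "E (p x) (p (f x))"
        using f aA a'(1) that unfolding good_def by blast+
      consider "x = a" | "x = a'" | "f' x = f x" unfolding f'_def by fastforce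
      then show ?thesis using E tw f'a by cases auto
    qed
    moreover have "X = A" if X: "X \<subseteq> A" "X \<noteq> {}" "closed f' X" for X
    proof -
      \<comment> \<open>The pair \<open>a\<close>, \<open>a'\<close> stays linked under
        \<open>f'\<close>: the exchange preserves either equality in \<open>tw\<close>.\<close>
      have both: "a \<in> X \<longleftrightarrow> a' \<in> X"
        using X(3) tw aA a' f'a unfolding closed_def by metis
      have "closed f X"
        unfolding closed_def
      proof (intro ballI impI)
        fix x y assume x: "x \<in> X" and y: "y \<in> A" and xy: "p x = p y \<or> p (f x) = p (f y)"
        \<comment> \<open>Since \<open>f' \<circ> \<tau> = f\<close>, a link through partners under
          \<open>f\<close> is one between \<open>\<tau>\<close>-images under \<open>f'\<close>, and
          \<open>\<tau>\<close> preserves \<open>X\<close>.\<close>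
        define \<tau> where "\<tau> = id(a := a', a' := a)"
        have \<tau>: "f' (\<tau> z) = f z" for z using ne by (auto simp: \<tau>_def f'_def)
        have \<tau>X: "\<tau> z \<in> X \<longleftrightarrow> z \<in> X" for z using both ne by (auto simp: \<tau>_def)
        have \<tau>A: "\<tau> z \<in> A" if "z \<in> A" for z using that aA a' by (auto simp: \<tau>_def)
        show "y \<in> X"
          using xy X(3) x y \<tau> \<tau>X \<tau>A unfolding closed_def by metis
      qed
      then show ?thesis using f X unfolding good_def by blast
    qed
    ultimately have "good f'" using bij unfolding good_def by blast
    moreover have "g \<circ> f' = (g \<circ> f)(a := (g \<circ> f) a', a' := (g \<circ> f) a)"
      by (auto simp: f'_def)
    then have "?R \<subset> orb A (g \<circ> f') s"
      using orb_grows_by_swap[OF fin bij_h[OF f] s a a'] by simp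
    then have "card ?R < card (orb A (g \<circ> f') s)"
      using fin orbA by (meson finite_subset psubset_card_mono)
    ultimately show False using max[of f'] by linarith
  qed
  then have "?R = A" using f R unfolding good_def by blast
  then show ?thesis using f unfolding good_def by blast
qed

section \<open>Cutting a cycle into paths\<close>

lemma funpow_in: "h ` A \<subseteq> A \<Longrightarrow> x \<in> A \<Longrightarrow> (h ^^ i) x \<in> A"
  by (induction i) auto

text \<open>Walk \<open>s, f s, h s, f (h s), ...\<close> with \<open>h = g \<circ> f\<close> and
  stop on first entering \<open>T\<close>; the next step would lead into \<open>S\<close>, to the
  start of a path.\<close>

lemma cut_single_orbit:
  assumes fin: "finite A" and f: "bij_betw f A B" and g: "bij_betw g B A"
    and disj: "A \<inter> B = {}" and ST: "S \<subseteq> A" "T \<subseteq> B" "g ` T = S"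
    and orbit: "s0 \<in> S" "orb A (g \<circ> f) s0 = A"
  shows "\<exists>P. (\<forall>s\<in>S. P s \<noteq> [] \<and> hd (P s) = s \<and> last (P s) \<in> T \<and> distinct (P s) \<and>
        (\<forall>j. Suc j < length (P s) \<longrightarrow> (P s ! j \<in> A \<and> P s ! Suc j = f (P s ! j)) \<or>
            (P s ! j \<in> B - T \<and> P s ! Suc j = g (P s ! j)))) \<and>
      (\<forall>s\<in>S. \<forall>s'\<in>S. s \<noteq> s' \<longrightarrow> set (P s) \<inter> set (P s') = {}) \<and>
      (\<Union>s\<in>S. set (P s)) = A \<union> B"
proof -
  define h where "h = g \<circ> f"
  have bij: "bij_betw h A A" using f g bij_betw_trans unfolding h_def by blast
  then have hA: "h ` A \<subseteq> A" and inj: "inj_on h A" by (auto simp: bij_betw_def)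
  have fA: "f x \<in> B" if "x \<in> A" for x using that f by (auto simp: bij_betw_def)
  have gT: "g b \<in> S \<longleftrightarrow> b \<in> T" if "b \<in> B" for b
  proof -
    have "b \<in> T" if "g b = g c" "c \<in> T" for c
      using that \<open>b \<in> B\<close> ST(2) g by (metis bij_betw_def inj_onD subsetD)
    then show ?thesis using ST(3) by blast
  qed
  have powA: "(h ^^ i) s \<in> A" if "s \<in> S" for i s using funpow_in[OF hA] that ST by blast
  \<comment> \<open>Iterating \<open>h\<close> returns to \<open>s\<close>; the element of
    \<open>B\<close> just before \<open>s\<close> is mapped into \<open>S\<close> by
    \<open>g\<close>, hence lies in \<open>T\<close>.\<close>
  have ex: "\<exists>k. f ((h ^^ k) s) \<in> T" if s: "s \<in> S" for s
  proof -
    let ?X = "range (\<lambda>k. (h ^^ k) s)"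
    have X: "?X \<subseteq> A" using powA s by blast
    have hX: "h ` ?X \<subseteq> ?X"
    proof
      fix y assume "y \<in> h ` ?X"
      then obtain k where "y = (h ^^ Suc k) s" by auto
      then show "y \<in> ?X" by blast
    qed
    have "h ` ?X = ?X"
      using fin inj X hX by (meson card_image card_subset_eq finite_subset inj_on_subset)
    moreover have "s \<in> ?X" using rangeI[of "\<lambda>k. (h ^^ k) s" 0] by simp
    ultimately obtain k where "h ((h ^^ k) s) = s" by (metis (no_types, lifting) imageE)
    then have "g (f ((h ^^ k) s)) \<in> S" using s by (simp add: h_def)
    then show ?thesis using gT fA powA s by blast
  qed
  define K where "K s = (LEAST k. f ((h ^^ k) s) \<in> T)" for s
  have KT: "f ((h ^^ K s) s) \<in> T" if "s \<in> S" for s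
    unfolding K_def using ex[OF that] by (rule LeastI_ex)
  have Kless: "f ((h ^^ i) s) \<notin> T" if "i < K s" for i s
    using that not_less_Least unfolding K_def by blast
  have new: "(h ^^ Suc i) s \<notin> S" if "s \<in> S" "i < K s" for i s
    using gT[OF fA[OF powA[OF that(1), of i]]] Kless[OF that(2)] by (simp add: h_def)
  \<comment> \<open>Cancel \<open>i\<close> steps by injectivity of \<open>h\<close>. What remains
    is a point of \<open>S\<close> on the walk from \<open>s'\<close>, which by \<open>new\<close>
    can only be its start.\<close>
  have uniq_le: "i = j \<and> s = s'"
    if "s \<in> S" "s' \<in> S" "i \<le> j" "j \<le> K s'" "(h ^^ i) s = (h ^^ j) s'" for i j s s'
    using that
  proof (induction i arbitrary: j)
    case 0
    then show ?case using new[of s' "j - 1"] by (cases j) auto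
  next
    case (Suc i)
    then obtain l where l: "j = Suc l" by (cases j) auto
    then have "h ((h ^^ i) s) = h ((h ^^ l) s')" using Suc.prems by simp
    then have "(h ^^ i) s = (h ^^ l) s'" using inj powA Suc.prems by (metis inj_onD)
    then show ?case using Suc l by auto
  qed
  have uniq: "i = j \<and> s = s'"
    if "s \<in> S" "s' \<in> S" "i \<le> K s" "j \<le> K s'" "(h ^^ i) s = (h ^^ j) s'" for i j s s'
    using uniq_le[of s s' i j] uniq_le[of s' s j i] that by (metis linear)
  \<comment> \<open>Even positions are points of \<open>A\<close>, odd ones their
    \<open>f\<close>-partners. Position \<open>2 * K s + 1\<close> is the first in \<open>T\<close>,
    so the path has \<open>2 * K s + 2\<close> vertices.\<close>
  define w where "w s j = (if even j then (h ^^ (j div 2)) s else f ((h ^^ (j div 2)) s))"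
    for s and j :: nat
  define P where "P s = map (w s) [0..<2 * K s + 2]" for s
  have w_in: "if even j then w s j \<in> A else w s j \<in> B" if "s \<in> S" for s j
    using that powA fA by (auto simp: w_def)
  have w_uniq: "j = l \<and> s = s'"
    if s: "s \<in> S" "s' \<in> S" and j: "j < 2 * K s + 2" "l < 2 * K s' + 2" and eq: "w s j = w s' l"
    for j l s s'
  proof -
    have par: "even j \<longleftrightarrow> even l" using w_in s eq disj by (metis disjoint_iff)
    have "(h ^^ (j div 2)) s = (h ^^ (l div 2)) s'"
      using par eq f powA s unfolding w_def by (metis bij_betw_def inj_onD)
    then have "j div 2 = l div 2 \<and> s = s'" using j by (intro uniq s) auto
    then show ?thesis using par by (metis dvd_mult_div_cancel odd_two_times_div_two_succ)
  qed
  have set_P: "set (P s) = w s ` {..<2 * K s + 2}" for s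
    by (simp add: P_def atLeast0LessThan del: upt_Suc)
  have "P s \<noteq> [] \<and> hd (P s) = s \<and> last (P s) \<in> T \<and> distinct (P s) \<and>
        (\<forall>j. Suc j < length (P s) \<longrightarrow> (P s ! j \<in> A \<and> P s ! Suc j = f (P s ! j)) \<or>
            (P s ! j \<in> B - T \<and> P s ! Suc j = g (P s ! j)))" if s: "s \<in> S" for s
  proof (intro conjI allI impI)
    show "P s \<noteq> []" by (simp add: P_def)
    show "hd (P s) = s" by (simp add: P_def w_def hd_map del: upt_Suc)
    show "last (P s) \<in> T" using KT[OF s] by (simp add: P_def w_def)
    show "distinct (P s)" unfolding P_def distinct_map
      using w_uniq[OF s s] by (auto simp: inj_on_def simp del: upt_Suc)
    fix j assume "Suc j < length (P s)"
    then have j: "Suc j < 2 * K s + 2" by (simp add: P_def)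
    then have nth: "P s ! j = w s j" "P s ! Suc j = w s (Suc j)"
      by (simp_all add: P_def nth_map del: upt_Suc)
    show "(P s ! j \<in> A \<and> P s ! Suc j = f (P s ! j)) \<or>
            (P s ! j \<in> B - T \<and> P s ! Suc j = g (P s ! j))"
    proof (cases "even j")
      case True
      then show ?thesis unfolding nth using powA s by (auto simp: w_def)
    next
      case False
      then have "j div 2 < K s" using j by presburger
      then have "w s j \<notin> T" using Kless False by (simp add: w_def)
      moreover have "w s (Suc j) = g (w s j)" using False by (simp add: w_def h_def)
      moreover have "w s j \<in> B" using w_in[OF s, of j] False by simp
      ultimately show ?thesis unfolding nth by blast
    qed
  qed
  moreover have "set (P s) \<inter> set (P s') = {}" if "s \<in> S" "s' \<in> S" "s \<noteq> s'" for s s'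
    unfolding set_P using w_uniq[OF that(1,2)] that(3) by blast
  moreover have "(\<Union>s\<in>S. set (P s)) = A \<union> B"
  proof
    show "(\<Union>s\<in>S. set (P s)) \<subseteq> A \<union> B" unfolding set_P using w_in by (fastforce split: if_splits)
    \<comment> \<open>The visited points of \<open>A\<close> form an \<open>h\<close>-invariant set,
      because after the end of a walk \<open>g\<close> leads from \<open>T\<close> to a start in
      \<open>S\<close>. Hence they contain the orbit of \<open>s0\<close>.\<close>
    let ?X = "{(h ^^ i) s | s i. s \<in> S \<and> i \<le> K s}"
    have "h ` ?X \<subseteq> ?X"
    proof
      fix y assume "y \<in> h ` ?X"
      then obtain s i where si: "s \<in> S" "i \<le> K s" "y = (h ^^ Suc i) s" by auto
      show "y \<in> ?X"
      proof (cases "i = K s")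
        case True
        then have "y \<in> S" using si gT fA powA KT by (simp add: h_def)
        then show ?thesis by (auto intro!: exI[of _ y] exI[of _ 0])
      next
        case False
        then show ?thesis using si by (auto intro!: exI[of _ s] exI[of _ "Suc i"] simp del: funpow.simps)
      qed
    qed
    moreover have "s0 \<in> ?X" using orbit by (auto intro!: exI[of _ s0] exI[of _ 0])
    moreover have "?X \<subseteq> A" using powA by blast
    ultimately have XA: "A \<subseteq> ?X" using orb_least[of ?X A s0 h] orbit(2) unfolding h_def by blast
    have "a \<in> (\<Union>s\<in>S. set (P s)) \<and> f a \<in> (\<Union>s\<in>S. set (P s))" if aA: "a \<in> A" for a
    proof -
      obtain s i where si: "s \<in> S" "i \<le> K s" "a = (h ^^ i) s" using subsetD[OF XA aA] by auto
      have "a = w s (2 * i)" "f a = w s (2 * i + 1)" using si by (auto simp: w_def)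
      moreover have "2 * i < 2 * K s + 2" "2 * i + 1 < 2 * K s + 2" using si by auto
      ultimately have "a \<in> set (P s)" "f a \<in> set (P s)" unfolding set_P
        using imageI[of "2 * i" "{..<2 * K s + 2}" "w s"]
          imageI[of "2 * i + 1" "{..<2 * K s + 2}" "w s"] by simp_all
      then show ?thesis using si(1) by blast
    qed
    moreover have "B = f ` A" using f by (simp add: bij_betw_def)
    ultimately show "A \<union> B \<subseteq> (\<Union>s\<in>S. set (P s))" by blast
  qed
  ultimately show ?thesis by (intro exI[of _ P]) blast
qed

section \<open>Vertex expansion\<close>

lemma bh_vertices_0: "bh_vertices 0 = {[]}"
  by (auto simp: bh_vertices_def)

lemma Cons_in_bh_vertices [simp]:
  "y # x \<in> bh_vertices (Suc m) \<longleftrightarrow> y < 4 \<and> x \<in> bh_vertices m"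
  by (auto simp: bh_vertices_def less_Suc_eq_0_disj)

lemma in_bh_vertices_SucE:
  assumes "v \<in> bh_vertices (Suc m)"
  obtains y x where "v = y # x" "y < 4" "x \<in> bh_vertices m"
proof (cases v)
  case Nil
  then show ?thesis using assms by (simp add: bh_vertices_def)
next
  case (Cons y x)
  then show ?thesis using assms that by simp
qed

lemma bh_vertices_Suc: "bh_vertices (Suc m) = (\<Union>y<4. Cons y ` bh_vertices m)"
  by (auto elim!: in_bh_vertices_SucE)

lemma finite_bh_vertices [simp]: "finite (bh_vertices m)"
  by (induction m) (auto simp: bh_vertices_0 bh_vertices_Suc)

definition slice :: "nat list set \<Rightarrow> nat \<Rightarrow> nat list set" where
  "slice Y j = {x. j # x \<in> Y}"

lemma slice_subset: "Y \<subseteq> bh_vertices (Suc m) \<Longrightarrow> slice Y j \<subseteq> bh_vertices m"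
  by (auto simp: slice_def)

lemma card_eq_sum_slices:
  assumes "Y \<subseteq> bh_vertices (Suc m)"
  shows "card Y = (\<Sum>j<4. card (slice Y j))"
proof -
  have "Y = (\<Union>j<4. Cons j ` slice Y j)"
  proof
    show "Y \<subseteq> (\<Union>j<4. Cons j ` slice Y j)"
    proof
      fix v assume v: "v \<in> Y"
      then obtain y x where "v = y # x" "y < 4" using assms in_bh_vertices_SucE by blast
      then show "v \<in> (\<Union>j<4. Cons j ` slice Y j)" using v by (auto simp: slice_def)
    qed
  qed (auto simp: slice_def)
  also have "card \<dots> = (\<Sum>j<4. card (Cons j ` slice Y j))"
    using finite_subset[OF slice_subset[OF assms] finite_bh_vertices]
    by (intro card_UN_disjoint) auto
  also have "\<dots> = (\<Sum>j<4. card (slice Y j))"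
    by (intro sum.cong refl card_image) (auto simp: inj_on_def)
  finally show ?thesis .
qed

lemma card_bh_vertices: "card (bh_vertices m) = 4 ^ m"
proof (induction m)
  case (Suc m)
  have "slice (bh_vertices (Suc m)) j = bh_vertices m" if "j < 4" for j
    using that by (auto simp: slice_def)
  then show ?case using Suc by (simp add: card_eq_sum_slices[OF subset_refl])
qed (simp add: bh_vertices_0)

text \<open>Dropping the first coordinate, an even vertex over \<open>x\<close> is adjacent to exactly the odd vertices over
  the points of \<open>nb x\<close>, namely \<open>x\<close> itself and the points \<open>x + e\<^sub>i\<close>.\<close>

fun nb :: "nat list \<Rightarrow> nat list set" where
  "nb [] = {[]}"
| "nb (y # x) = insert ((y + 1) mod 4 # x) (Cons y ` nb x)"

definition Nb :: "nat list set \<Rightarrow> nat list set" where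
  "Nb Y = \<Union>(nb ` Y)"

lemma self_in_nb: "x \<in> nb x"
  by (induction x) auto

lemma nb_subset: "x \<in> bh_vertices m \<Longrightarrow> nb x \<subseteq> bh_vertices m"
proof (induction x arbitrary: m)
  case (Cons y x)
  then obtain k where "m = Suc k" by (cases m) (auto simp: bh_vertices_0)
  then show ?case using Cons.IH[of k] Cons.prems by auto
qed simp

lemma Nb_subset: "Y \<subseteq> bh_vertices m \<Longrightarrow> Nb Y \<subseteq> bh_vertices m"
  using nb_subset unfolding Nb_def by blast

lemma subset_Nb: "Y \<subseteq> Nb Y"
  using self_in_nb unfolding Nb_def by blast

lemma add_mod4_cancel:
  fixes a b c :: nat
  assumes "(a + c) mod 4 = (b + c) mod 4" "a < 4" "b < 4"
  shows "a = b"
proof -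
  have "(a + c + 3 * c) mod 4 = (b + c + 3 * c) mod 4"
    using assms(1) by (rule mod_add_cong) simp
  then show ?thesis using assms(2,3) by simp
qed

text \<open>A step to a neighbour either stays in its layer of the first coordinate or enters from
  the cyclically preceding one.\<close>

lemma slice_Nb:
  assumes "Y \<subseteq> bh_vertices (Suc m)" "j < 4"
  shows "slice (Nb Y) ((j + 1) mod 4) = Nb (slice Y ((j + 1) mod 4)) \<union> slice Y j"
proof
  define i where "i = (j + 1) mod 4"
  show "slice (Nb Y) i \<subseteq> Nb (slice Y i) \<union> slice Y j"
  proof
    fix x assume "x \<in> slice (Nb Y) i"
    then obtain v where v: "v \<in> Y" "i # x \<in> nb v" by (auto simp: slice_def Nb_def)
    then obtain k u where u: "v = k # u" "k < 4" using assms(1) in_bh_vertices_SucE by blast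
    then consider "i = (k + 1) mod 4" "x = u" | "i = k" "x \<in> nb u" using v by auto
    then show "x \<in> Nb (slice Y i) \<union> slice Y j"
    proof cases
      case 1
      then have "k = j" using add_mod4_cancel[of k 1 j] assms(2) u(2) by (simp add: i_def)
      then show ?thesis using 1 u v by (simp add: slice_def)
    next
      case 2
      then show ?thesis using u v by (auto simp: slice_def Nb_def)
    qed
  qed
  show "Nb (slice Y i) \<union> slice Y j \<subseteq> slice (Nb Y) i"
    by (force simp: slice_def Nb_def i_def)
qed

lemma Suc_le_four_power: "Suc m \<le> 4 ^ m"
  by (induction m) auto

text \<open>Induction over the four cyclic layers of the first coordinate. Either some layer gains
  \<open>m\<close> by induction, and no gain elsewhere would make every layer full; or every
  nonempty slice dominates its layer, and passing from a nonempty slice to an empty one gains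
  \<open>4 ^ m\<close>.\<close>

lemma card_Nb_ge:
  assumes "Y \<subseteq> bh_vertices m" "Y \<noteq> {}" "Nb Y \<noteq> bh_vertices m"
  shows "card Y + m \<le> card (Nb Y)"
  using assms
proof (induction m arbitrary: Y)
  case 0
  then show ?case using subset_Nb[of Y] Nb_subset[of Y 0] by (auto simp: bh_vertices_0)
next
  case (Suc m)
  note Y = Suc.prems(1)
  let ?Q = "bh_vertices m"
  define y where "y = slice Y"
  define z where "z = slice (Nb Y)"
  have yQ: "y j \<subseteq> ?Q" for j unfolding y_def using slice_subset[OF Y] .
  have zQ: "z j \<subseteq> ?Q" for j unfolding z_def using slice_subset[OF Nb_subset[OF Y]] .
  have finz: "finite (z j)" for j using zQ finite_subset finite_bh_vertices by blast
  have cardY: "card Y = card (y 0) + card (y 1) + card (y 2) + card (y 3)"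
    using card_eq_sum_slices[OF Y] by (simp add: y_def numeral_eq_Suc)
  have cardN: "card (Nb Y) = card (z 0) + card (z 1) + card (z 2) + card (z 3)"
    using card_eq_sum_slices[OF Nb_subset[OF Y]] by (simp add: z_def numeral_eq_Suc)
  have z_eq: "z i = Nb (y i) \<union> y j" if "j < 4" "i = (j + 1) mod 4" for i j
    using slice_Nb[OF Y that(1)] that(2) by (simp add: y_def z_def)
  have zs: "z 1 = Nb (y 1) \<union> y 0" "z 2 = Nb (y 2) \<union> y 1"
      "z 3 = Nb (y 3) \<union> y 2" "z 0 = Nb (y 0) \<union> y 3"
    by (rule z_eq; simp)+
  have four: "j \<in> {0, 1, 2, 3}" if "j < 4" for j :: nat using that by auto
  have Nz: "Nb (y j) \<subseteq> z j" if "j < 4" for j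
    using four[OF that] zs by auto
  have le: "card (y j) \<le> card (z j)" if "j < 4" for j
    using Nz[OF that] subset_Nb[of "y j"] finz by (meson card_mono order_trans)
  have notall: "\<exists>j<4. z j \<noteq> ?Q"
  proof (rule ccontr)
    assume "\<not> ?thesis"
    then have "\<forall>j<4. z j = ?Q" by blast
    then have "bh_vertices (Suc m) \<subseteq> Nb Y"
      unfolding z_def by (force simp: slice_def elim!: in_bh_vertices_SucE)
    then show False using Suc.prems(3) Nb_subset[OF Y] by blast
  qed
  \<comment> \<open>For \<open>m > 0\<close> the gain from the induction hypothesis contradicts
    closure under \<open>Nb\<close>; for \<open>m = 0\<close> a layer is a single point.\<close>
  have full: "y k = ?Q" if "y k \<noteq> {}" "Nb (y k) \<subseteq> y k" for k
  proof (cases "m = 0")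
    case True
    then show ?thesis using that(1) yQ[of k] by (auto simp: bh_vertices_0)
  next
    case False
    have "card (Nb (y k)) \<le> card (y k)"
      using that yQ finite_subset finite_bh_vertices by (meson card_mono)
    then have "Nb (y k) = ?Q" using Suc.IH[OF yQ that(1)] False by linarith
    then show ?thesis using that yQ by blast
  qed
  have step: "y k = ?Q \<and> z k = ?Q" if "card (z k) = card (y k)" "k < 4" "w \<subseteq> z k" "w \<noteq> {}" for k w
  proof -
    have "y k = z k"
      using that Nz[of k] subset_Nb[of "y k"] finz[of k]
      by (metis card_subset_eq order_trans)
    then show ?thesis using full[of k] that Nz[of k] by blast
  qed
  show ?case
  proof (cases "\<exists>j<4. y j \<noteq> {} \<and> Nb (y j) \<noteq> ?Q")
    case True
    then obtain j where j: "j < 4" "y j \<noteq> {}" "Nb (y j) \<noteq> ?Q" by blast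
    have gap: "card (y j) + m \<le> card (z j)"
      using Suc.IH[OF yQ j(2,3)] card_mono[OF finz Nz[OF j(1)]] by linarith
    show ?thesis
    proof (rule ccontr)
      assume "\<not> ?thesis"
      then have eq: "card (z k) = card (y k)" if "k < 4" "k \<noteq> j" for k
        using gap le[of 0] le[of 1] le[of 2] le[of 3] four[OF j(1)] four[OF that(1)] that(2)
        unfolding cardY cardN by auto
      have st: "y k = ?Q \<and> z k = ?Q" if "k < 4" "k \<noteq> j" "w \<subseteq> z k" "w \<noteq> {}" for k w
        using step[OF eq] that by blast
      have sub: "y 0 \<subseteq> z 1" "y 1 \<subseteq> z 2" "y 2 \<subseteq> z 3" "y 3 \<subseteq> z 0" using zs by blast+
      \<comment> \<open>Starting after \<open>j\<close>, each layer receives a point from its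
        predecessor and is tight, hence full; after one turn, layer \<open>j\<close> of
        \<open>Nb Y\<close> is full too.\<close>
      have "z k = ?Q" if "k < 4" for k
      proof -
        have Q0: "?Q \<noteq> {}" using j yQ by blast
        consider "j = 0" | "j = 1" | "j = 2" | "j = 3" using four[OF j(1)] by auto
        then have "z 0 = ?Q \<and> z 1 = ?Q \<and> z 2 = ?Q \<and> z 3 = ?Q"
        proof cases
          case 1
          have q1: "y 1 = ?Q \<and> z 1 = ?Q"
            by (rule st[of 1 "y 0"]) (use 1 j(2) sub in simp_all)
          have q2: "y 2 = ?Q \<and> z 2 = ?Q"
            by (rule st[of 2 "?Q"]) (use 1 Q0 sub q1 in simp_all)
          have q3: "y 3 = ?Q \<and> z 3 = ?Q"
            by (rule st[of 3 "?Q"]) (use 1 Q0 sub q2 in simp_all)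
          have "z 0 = ?Q" by (rule subset_antisym) (use sub(4) q3 zQ[of 0] in simp_all)
          with q1 q2 q3 show ?thesis by simp
        next
          case 2
          have q1: "y 2 = ?Q \<and> z 2 = ?Q"
            by (rule st[of 2 "y 1"]) (use 2 j(2) sub in simp_all)
          have q2: "y 3 = ?Q \<and> z 3 = ?Q"
            by (rule st[of 3 "?Q"]) (use 2 Q0 sub q1 in simp_all)
          have q3: "y 0 = ?Q \<and> z 0 = ?Q"
            by (rule st[of 0 "?Q"]) (use 2 Q0 sub q2 in simp_all)
          have "z 1 = ?Q" by (rule subset_antisym) (use sub(1) q3 zQ[of 1] in simp_all)
          with q1 q2 q3 show ?thesis by simp
        next
          case 3
          have q1: "y 3 = ?Q \<and> z 3 = ?Q"
            by (rule st[of 3 "y 2"]) (use 3 j(2) sub in simp_all)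
          have q2: "y 0 = ?Q \<and> z 0 = ?Q"
            by (rule st[of 0 "?Q"]) (use 3 Q0 sub q1 in simp_all)
          have q3: "y 1 = ?Q \<and> z 1 = ?Q"
            by (rule st[of 1 "?Q"]) (use 3 Q0 sub q2 in simp_all)
          have "z 2 = ?Q" by (rule subset_antisym) (use sub(2) q3 zQ[of 2] in simp_all)
          with q1 q2 q3 show ?thesis by simp
        next
          case 4
          have q1: "y 0 = ?Q \<and> z 0 = ?Q"
            by (rule st[of 0 "y 3"]) (use 4 j(2) sub in simp_all)
          have q2: "y 1 = ?Q \<and> z 1 = ?Q"
            by (rule st[of 1 "?Q"]) (use 4 Q0 sub q1 in simp_all)
          have q3: "y 2 = ?Q \<and> z 2 = ?Q"
            by (rule st[of 2 "?Q"]) (use 4 Q0 sub q2 in simp_all)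
          have "z 3 = ?Q" by (rule subset_antisym) (use sub(3) q3 zQ[of 3] in simp_all)
          with q1 q2 q3 show ?thesis by simp
        qed
        then show ?thesis using four[OF that] by auto
      qed
      then show False using notall by blast
    qed
  next
    case False
    then have dich: "y j = {} \<or> Nb (y j) = ?Q" if "j < 4" for j using that by blast
    obtain j where j: "j < 4" "z j \<noteq> ?Q" using notall by blast
    then have yj: "y j = {}" using dich Nz zQ by blast
    obtain v where "v \<in> Y" using Suc.prems(2) by blast
    then obtain i x where "i < 4" "x \<in> y i"
      using Y unfolding y_def slice_def by (metis in_bh_vertices_SucE mem_Collect_eq subsetD)
    then have i: "i < 4" "y i \<noteq> {}" by auto
    \<comment> \<open>On the cyclic way from the nonempty layer \<open>i\<close> to the empty layer
      \<open>j\<close>, some step leaves a nonempty layer for an empty one.\<close>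
    have "\<exists>k<4. y k \<noteq> {} \<and> y ((k + 1) mod 4) = {}"
    proof (rule ccontr)
      assume "\<not> ?thesis"
      then have succ: "y ((k + 1) mod 4) \<noteq> {}" if "k < 4" "y k \<noteq> {}" for k using that by blast
      have "y ((i + d) mod 4) \<noteq> {}" for d
      proof (induction d)
        case (Suc d)
        then show ?case using succ[of "(i + d) mod 4"] by (simp add: mod_Suc_eq)
      qed (use i in simp)
      from this[of "j + 4 - i"] show False using i(1) j(1) yj by simp
    qed
    then obtain k l where k: "k < 4" "y k \<noteq> {}" "l = (k + 1) mod 4" "y l = {}" by blast
    \<comment> \<open>Layer \<open>k\<close> of \<open>Nb Y\<close> is full, and
      \<open>card (y k)\<close> is recovered in layer \<open>l\<close>, where \<open>Y\<close> is
      empty. The gain is thus at least \<open>4 ^ m\<close>, which is at least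
      \<open>Suc m\<close>.\<close>
    have "card (z k) \<ge> 4 ^ m"
      using dich[OF k(1)] k(2) Nz[OF k(1)] zQ[of k] by (simp add: card_bh_vertices[symmetric])
    moreover have "card (z l) \<ge> card (y k)"
      using z_eq[OF k(1,3)] finz[of l] by (simp add: card_mono)
    moreover have "card (y l) = 0" using k(4) by simp
    moreover have "k = 0 \<and> l = 1 \<or> k = 1 \<and> l = 2 \<or> k = 2 \<and> l = 3 \<or> k = 3 \<and> l = 0"
      using k(1,3) by presburger
    ultimately show ?thesis
      using le[of 0] le[of 1] le[of 2] le[of 3] Suc_le_four_power[of m]
      unfolding cardY cardN by auto
  qed
qed

section \<open>A Hamiltonian cycle of the quotient\<close>

text \<open>A Hamiltonian cycle of the Cayley digraph of \<open>\<int>\<^sub>4\<^sup>m\<close> with respect to the unit vectors: advance the first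
  coordinate when the coordinate sum is 0, and otherwise follow the cycle of the remaining coordinates.
  Four steps thus advance the first coordinate once and the smaller cycle three times.\<close>

fun nxt :: "nat list \<Rightarrow> nat list" where
  "nxt [] = []"
| "nxt (y # x) = (if x = [] \<or> (y + sum_list x) mod 4 = 0 then (y + 1) mod 4 # x else y # nxt x)"

lemma nxt_in_nb: "x \<noteq> [] \<Longrightarrow> nxt x \<in> nb x"
  by (induction x) auto

lemma nxt_in_bh_vertices: "x \<in> bh_vertices m \<Longrightarrow> nxt x \<in> bh_vertices m"
  using nxt_in_nb[of x] nb_subset[of x m] by (cases "x = []") auto

lemma nxt_power_in_bh_vertices: "x \<in> bh_vertices m \<Longrightarrow> (nxt ^^ k) x \<in> bh_vertices m"
  by (induction k) (auto simp: nxt_in_bh_vertices)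

lemma length_nxt [simp]: "length (nxt x) = length x"
  by (induction x) auto

lemma nxt_eq_Nil_iff [simp]: "nxt x = [] \<longleftrightarrow> x = []"
  by (metis length_0_conv length_nxt)

text \<open>The coordinate sum modulo 4 is the clock that controls the branches of
  \<open>nxt\<close>.\<close>

lemma sum_list_nxt: "x \<noteq> [] \<Longrightarrow> sum_list (nxt x) mod 4 = (sum_list x + 1) mod 4"
proof (induction x)
  case (Cons y x)
  show ?case
  proof (cases "x = [] \<or> (y + sum_list x) mod 4 = 0")
    case True
    have "((y + 1) mod 4 + sum_list x) mod 4 = (y + sum_list x + 1) mod 4" by presburger
    then show ?thesis using True by simp
  next
    case False
    then have "sum_list (nxt x) mod 4 = (sum_list x + 1) mod 4" using Cons by simp
    then have "(y + sum_list (nxt x)) mod 4 = (y + (sum_list x + 1)) mod 4"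
      by (rule mod_add_cong[OF refl])
    then show ?thesis using False by simp
  qed
qed simp

lemma sum_list_nxt_power:
  "x \<noteq> [] \<Longrightarrow> (nxt ^^ k) x \<noteq> [] \<and> sum_list ((nxt ^^ k) x) mod 4 = (sum_list x + k) mod 4"
proof (induction k)
  case (Suc k)
  then show ?case using sum_list_nxt[of "(nxt ^^ k) x"] by (auto simp: mod_Suc)
qed simp

text \<open>The clock shows that two points with the same image were advanced by the same branch,
  which can be cancelled modulo 4 or by induction.\<close>

lemma inj_on_nxt: "inj_on nxt (bh_vertices m)"
proof (induction m)
  case 0
  show ?case by (simp add: bh_vertices_0)
next
  case (Suc m)
  show ?case
  proof (rule inj_onI)
    fix u v assume u: "u \<in> bh_vertices (Suc m)" and v: "v \<in> bh_vertices (Suc m)"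
      and eq: "nxt u = nxt v"
    obtain y x where yx: "u = y # x" "y < 4" "x \<in> bh_vertices m"
      using u by (rule in_bh_vertices_SucE)
    obtain y' x' where yx': "v = y' # x'" "y' < 4" "x' \<in> bh_vertices m"
      using v by (rule in_bh_vertices_SucE)
    have "(sum_list u + 1) mod 4 = (sum_list v + 1) mod 4"
      using sum_list_nxt[of u] sum_list_nxt[of v] unfolding eq by (simp add: yx(1) yx'(1))
    then have sums: "sum_list u mod 4 = sum_list v mod 4" by (auto simp: mod_Suc split: if_splits)
    have nil: "x = [] \<longleftrightarrow> x' = []"
      using yx(3) yx'(3) by (auto simp: bh_vertices_def)
    have y: "y = y'" if "(y + 1) mod 4 = (y' + 1) mod 4" using add_mod4_cancel[OF that] yx yx' by simp
    have x: "x = x'" if "nxt x = nxt x'" using that inj_onD[OF Suc that] yx yx' by blast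
    show "u = v"
      using eq sums nil y x yx(1) yx'(1) by (auto split: if_splits)
  qed
qed

lemma sum_list_shifted:
  assumes "x \<noteq> []" "(y + sum_list x) mod 4 = 0"
  shows "((y + j) mod 4 + sum_list ((nxt ^^ k) x)) mod 4 = (j + k) mod 4"
proof -
  have "((y + j) mod 4 + sum_list ((nxt ^^ k) x)) mod 4 = (y + j + sum_list ((nxt ^^ k) x) mod 4) mod 4"
    by (simp add: mod_simps)
  also have "\<dots> = (y + j + (sum_list x + k)) mod 4"
    using sum_list_nxt_power[OF assms(1), of k] by (simp add: mod_simps)
  also have "\<dots> = ((y + sum_list x) mod 4 + (j + k)) mod 4"
    unfolding mod_add_left_eq by (simp add: ac_simps)
  finally show ?thesis using assms(2) by simp
qed

lemma nxt_power4:
  assumes "x \<noteq> []" "(y + sum_list x) mod 4 = 0"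
  shows "(nxt ^^ 4) (y # x) = (y + 1) mod 4 # (nxt ^^ 3) x"
proof -
  define z where "z = (y + 1) mod 4"
  \<comment> \<open>Once the head has moved, the clock reads 1, 2, 3 before the next three steps, so
    these move the tail.\<close>
  have ne: "(z + sum_list ((nxt ^^ k) x)) mod 4 \<noteq> 0" if "k < 3" for k
    using sum_list_shifted[OF assms, of 1 k] that by (simp add: z_def)
  have "nxt (y # x) = z # x" using assms by (simp add: z_def)
  moreover have "nxt (z # (nxt ^^ k) x) = z # (nxt ^^ Suc k) x" if "k < 3" for k
    using ne[OF that] sum_list_nxt_power[OF assms(1), of k] by simp
  from this[of 0] this[of 1] this[of 2]
  have "nxt (z # x) = z # nxt x" "nxt (z # nxt x) = z # nxt (nxt x)"
    "nxt (z # nxt (nxt x)) = z # nxt (nxt (nxt x))"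
    by (simp_all add: numeral_2_eq_2)
  ultimately show ?thesis unfolding z_def[symmetric]
    by (simp only: eval_nat_numeral funpow.simps comp_apply id_apply BitM.simps)
qed

lemma nxt_power4_mult:
  assumes "x \<noteq> []" "y < 4" "(y + sum_list x) mod 4 = 0"
  shows "(nxt ^^ (4 * j)) (y # x) = (y + j) mod 4 # (nxt ^^ (3 * j)) x"
proof (induction j)
  case (Suc j)
  have *: "((y + j) mod 4 + sum_list ((nxt ^^ (3 * j)) x)) mod 4 = 0"
    using sum_list_shifted[OF assms(1,3), of j "3 * j"] by simp
  have "(nxt ^^ (4 * Suc j)) (y # x) = (nxt ^^ 4) ((nxt ^^ (4 * j)) (y # x))"
    by (simp only: mult_Suc_right funpow_add comp_apply)
  also have "\<dots> = ((y + j) mod 4 + 1) mod 4 # (nxt ^^ 3) ((nxt ^^ (3 * j)) x)"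
    unfolding Suc using sum_list_nxt_power[OF assms(1), of "3 * j"] by (intro nxt_power4[OF _ *]) simp
  also have "((y + j) mod 4 + 1) mod 4 = (y + Suc j) mod 4" by (simp add: mod_Suc_eq)
  also have "(nxt ^^ 3) ((nxt ^^ (3 * j)) x) = (nxt ^^ (3 * Suc j)) x"
    by (simp only: mult_Suc_right funpow_add comp_apply)
  finally show ?case .
qed (use assms in auto)

lemma ex_sum_zero: "\<exists>r. ((k::nat) + r) mod 4 = 0"
  by (rule exI[of _ "4 * k - k"]) simp

lemma nxt_power_singleton: "y < 4 \<Longrightarrow> (nxt ^^ j) [y] = [(y + j) mod 4]"
  by (induction j) (simp_all add: mod_Suc_eq)

text \<open>In the induction step, \<open>4 ^ Suc m\<close> rounds of four steps from a point of sum
  0 advance the head by a multiple of 4 and the tail by three full turns of the smaller cycle. Any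
  other point is first moved to sum 0, which injectivity undoes.\<close>

lemma nxt_order: "x \<in> bh_vertices (Suc m) \<Longrightarrow> (nxt ^^ (4 ^ Suc m)) x = x"
proof (induction m arbitrary: x)
  case 0
  then obtain y where "x = [y]" "y < 4"
    by (metis in_bh_vertices_SucE bh_vertices_0 singletonD)
  then show ?case using nxt_power_singleton[of y 4] by simp
next
  case (Suc m)
  let ?L = "4 ^ Suc (Suc m) :: nat"
  have zero: "(nxt ^^ ?L) v = v" if v: "v \<in> bh_vertices (Suc (Suc m))" "sum_list v mod 4 = 0" for v
  proof -
    obtain y u where yu: "v = y # u" "y < 4" "u \<in> bh_vertices (Suc m)"
      using v(1) by (rule in_bh_vertices_SucE)
    have "u \<noteq> []" using yu(3) by (auto simp: bh_vertices_def)
    moreover have "(nxt ^^ (3 * 4 ^ Suc m)) u = u"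
    proof -
      have "3 * 4 ^ Suc m = 4 ^ Suc m + (4 ^ Suc m + 4 ^ Suc m :: nat)" by simp
      then show ?thesis using Suc.IH[OF yu(3)] by (simp only: funpow_add comp_apply)
    qed
    moreover have "(y + 4 ^ Suc m) mod 4 = y" using yu(2) by simp
    ultimately show ?thesis
      using nxt_power4_mult[of u y "4 ^ Suc m"] yu(1,2) v(2)
      by (simp only: power_Suc[of 4 "Suc m"] sum_list.Cons simp_thms)
  qed
  obtain r where r: "(sum_list x + r) mod 4 = 0" by (rule exE[OF ex_sum_zero])
  have ne: "x \<noteq> []" using Suc.prems by (auto simp: bh_vertices_def)
  have "(nxt ^^ r) ((nxt ^^ ?L) x) = (nxt ^^ ?L) ((nxt ^^ r) x)"
    by (metis add.commute comp_apply funpow_add)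
  also have "\<dots> = (nxt ^^ r) x"
    using sum_list_nxt_power[OF ne, of r] r Suc.prems
    by (intro zero nxt_power_in_bh_vertices) auto
  finally have eq: "(nxt ^^ r) ((nxt ^^ ?L) x) = (nxt ^^ r) x" .
  have "u = v" if "u \<in> bh_vertices (Suc (Suc m))" "v \<in> bh_vertices (Suc (Suc m))"
    "(nxt ^^ r) u = (nxt ^^ r) v" for u v r
    using that(3)
  proof (induction r)
    case (Suc r)
    then have "nxt ((nxt ^^ r) u) = nxt ((nxt ^^ r) v)" by simp
    then have "(nxt ^^ r) u = (nxt ^^ r) v"
      by (rule inj_onD[OF inj_on_nxt]) (use that(1,2) nxt_power_in_bh_vertices in blast)+
    then show ?case by (rule Suc.IH)
  qed simp
  from this[OF nxt_power_in_bh_vertices[OF Suc.prems] Suc.prems eq] show ?case .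
qed

text \<open>That is, \<open>nxt\<close> is a single cycle. Points of sum 0 are determined by their
  tails, on which four steps act as the cube of the smaller cycle. That cube is transitive because 3
  is invertible modulo a power of 4.\<close>

lemma nxt_transitive:
  assumes "Y \<subseteq> bh_vertices (Suc m)" "Y \<noteq> {}" "nxt ` Y \<subseteq> Y"
  shows "Y = bh_vertices (Suc m)"
  using assms
proof (induction m arbitrary: Y)
  case 0
  have one: "bh_vertices (Suc 0) = {[y] | y. y < 4}"
    by (auto simp: bh_vertices_0 elim!: in_bh_vertices_SucE)
  obtain y where y: "[y] \<in> Y" "y < 4" using 0 unfolding one by blast
  have reach: "[(y + j) mod 4] \<in> Y" for j
    using funpow_in[OF 0(3) y(1), of j] nxt_power_singleton[OF y(2), of j] by simp
  have "[k] \<in> Y" if "k < 4" for k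
    using reach[of "k + 4 - y"] that y(2) by simp
  then show ?case using 0(1) unfolding one by blast
next
  case (Suc m)
  note Y = Suc.prems
  let ?Q = "bh_vertices (Suc m)"
  have pow: "(nxt ^^ k) v \<in> Y" if "v \<in> Y" for k v using funpow_in[OF Y(3) that] .
  define Z where "Z = {x \<in> ?Q. \<exists>y<4. (y + sum_list x) mod 4 = 0 \<and> y # x \<in> Y}"
  have ZI: "x \<in> Z" if "x \<in> ?Q" "y < 4" "(y + sum_list x) mod 4 = 0" "y # x \<in> Y" for x y
    unfolding Z_def mem_Collect_eq by (intro conjI exI[of _ y] that)
  have ne: "x \<noteq> []" if "x \<in> ?Q" for x using that by (auto simp: bh_vertices_def)
  have "(nxt ^^ 3) x \<in> Z" if x: "x \<in> Z" for x
  proof -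
    obtain y where y: "x \<in> ?Q" "y < 4" "(y + sum_list x) mod 4 = 0" "y # x \<in> Y"
      using x by (auto simp: Z_def)
    have "(y + 1) mod 4 # (nxt ^^ 3) x \<in> Y"
      using pow[OF y(4), of 4] nxt_power4[OF ne[OF y(1)] y(3)] by metis
    moreover have "((y + 1) mod 4 + sum_list ((nxt ^^ 3) x)) mod 4 = 0"
      using sum_list_shifted[OF ne[OF y(1)] y(3), of 1 3] by simp
    ultimately show ?thesis
      unfolding Z_def using nxt_power_in_bh_vertices[OF y(1)]
      by (auto intro!: exI[of _ "(y + 1) mod 4"])
  qed
  then have Z3: "((nxt ^^ 3) ^^ k) x \<in> Z" if "x \<in> Z" for k x
    using funpow_in[of "nxt ^^ 3" Z] that by blast
  text \<open>Since 3 is invertible modulo the order \<open>4 ^ Suc m\<close> of \<open>nxt\<close>, invariance under the cube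
    gives invariance under \<open>nxt\<close> itself.\<close>
  have "\<exists>k. 2 * 4 ^ l + 1 = 3 * (k::nat)" for l
  proof (induction l)
    case (Suc l)
    then obtain k where "2 * 4 ^ l + 1 = 3 * (k::nat)" ..
    then have "2 * 4 ^ Suc l + 1 = 3 * (k + 2 * 4 ^ l)" by simp
    then show ?case ..
  qed (simp add: exI[of _ 1])
  then obtain k where k: "2 * 4 ^ Suc m + 1 = 3 * (k::nat)" by blast
  have "nxt x \<in> Z" if x: "x \<in> Z" for x
  proof -
    have xQ: "x \<in> ?Q" using x unfolding Z_def by blast
    have "(nxt ^^ (3 * k)) x = (nxt ^^ (1 + (4 ^ Suc m + 4 ^ Suc m))) x"
      using k by (simp add: mult_2)
    also have "\<dots> = nxt ((nxt ^^ 4 ^ Suc m) ((nxt ^^ 4 ^ Suc m) x))"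
      by (simp only: funpow_add comp_apply) simp
    finally have "(nxt ^^ (3 * k)) x = nxt x" using nxt_order[OF xQ] by simp
    then show ?thesis using Z3[OF x, of k] by (metis funpow_mult mult.commute)
  qed
  moreover have "Z \<noteq> {}"
  proof -
    obtain v where v: "v \<in> Y" using Y(2) by blast
    obtain r where r: "(sum_list v + r) mod 4 = 0" by (rule exE[OF ex_sum_zero])
    have w: "(nxt ^^ r) v \<in> Y" using pow[OF v] .
    have "v \<noteq> []" using v Y(1) by (auto simp: bh_vertices_def)
    then have s: "sum_list ((nxt ^^ r) v) mod 4 = 0" using sum_list_nxt_power r by metis
    obtain y x where yx: "(nxt ^^ r) v = y # x" "y < 4" "x \<in> ?Q"
      using w Y(1) in_bh_vertices_SucE by blast
    have "(y + sum_list x) mod 4 = 0" using s yx(1) by simp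
    then have "x \<in> Z" using w yx by (intro ZI[of x y]) simp_all
    then show ?thesis by blast
  qed
  moreover have "Z \<subseteq> ?Q" by (auto simp: Z_def)
  ultimately have Z: "Z = ?Q" by (intro Suc.IH) auto
  have "v \<in> Y" if v: "v \<in> bh_vertices (Suc (Suc m))" for v
  proof -
    obtain r where r: "(sum_list v + r) mod 4 = 0" by (rule exE[OF ex_sum_zero])
    define w where "w = (nxt ^^ r) v"
    have "v \<noteq> []" using v by (auto simp: bh_vertices_def)
    then have s: "sum_list w mod 4 = 0" using sum_list_nxt_power r unfolding w_def by metis
    have "w \<in> bh_vertices (Suc (Suc m))" using v nxt_power_in_bh_vertices by (simp add: w_def)
    then obtain y x where yx: "w = y # x" "y < 4" "x \<in> ?Q" by (rule in_bh_vertices_SucE)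
    then have "x \<in> Z" using Z by simp
    then obtain y' where y': "y' < 4" "(y' + sum_list x) mod 4 = 0" "y' # x \<in> Y"
      by (auto simp: Z_def)
    have "(y' + sum_list x) mod 4 = (y + sum_list x) mod 4" using y'(2) yx(1) s by simp
    then have "y' = y" using y'(1) yx(2) by (rule add_mod4_cancel)
    \<comment> \<open>Membership is carried back from \<open>w\<close> to \<open>v\<close> along the
      \<open>r\<close> steps.\<close>
    then have "w \<in> Y" using y' yx by simp
    then show ?thesis unfolding w_def
    proof (induction r)
      case (Suc r)
      then have "(nxt ^^ r) v \<in> Y"
        using invariant_set_backward[OF finite_bh_vertices inj_on_nxt Y(1,3)]
          nxt_power_in_bh_vertices[OF v] by simp
      then show ?case by (rule Suc.IH)
    qed simp
  qed
  then show ?case using Y(1) by blast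
qed

section \<open>Balanced hypercubes\<close>

lemma nb_cases:
  "y \<in> nb x \<Longrightarrow> y = x \<or> (\<exists>i<length x. y = x[i := (x ! i + 1) mod 4])"
proof (induction x arbitrary: y)
  case (Cons a x)
  then consider "y = (a + 1) mod 4 # x" | y' where "y' \<in> nb x" "y = a # y'" by auto
  then show ?case
  proof cases
    case 1
    then show ?thesis by (intro disjI2 exI[of _ 0]) simp
  next
    case 2
    from Cons.IH[OF 2(1)] show ?thesis
    proof
      assume "\<exists>i<length x. y' = x[i := (x ! i + 1) mod 4]"
      then obtain i where "i < length x" "y' = x[i := (x ! i + 1) mod 4]" by blast
      then show ?thesis using 2(2) by (intro disjI2 exI[of _ "Suc i"]) simp
    qed (use 2 in simp)
  qed
qed simp

lemma bh_V0_Suc: "bh_V0 (Suc m) = Cons 0 ` bh_vertices m \<union> Cons 2 ` bh_vertices m"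
proof -
  have "y = 0 \<or> y = 2" if "y < 4" "even y" for y :: nat using that by presburger
  then show ?thesis by (fastforce simp: bh_V0_def elim!: in_bh_vertices_SucE)
qed

lemma bh_V1_Suc: "bh_V1 (Suc m) = Cons 1 ` bh_vertices m \<union> Cons 3 ` bh_vertices m"
proof -
  have "y = 1 \<or> y = 3" if "y < 4" "odd y" for y :: nat using that by presburger
  then show ?thesis by (fastforce simp: bh_V1_def elim!: in_bh_vertices_SucE)
qed

lemma bh_adjI:
  assumes "u \<in> bh_vertices n" "v \<in> bh_vertices n" "1 \<le> i" "i < n"
    and "\<exists>d\<in>{1, -1}. a = nat ((int (u ! 0) + d) mod 4)"
    and "v = u[0 := a, i := nat ((int (u ! i) + (-1) ^ (u ! 0)) mod 4)]"
  shows "bh_adj n u v"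
proof -
  obtain d where d: "d \<in> {1, -1}" "a = nat ((int (u ! 0) + d) mod 4)" using assms(5) by blast
  show ?thesis
    unfolding bh_adj_def
    by (rule conjI[OF assms(1)], rule conjI[OF assms(2)], rule bexI[OF _ d(1)], rule disjI2)
      (rule exI[of _ i], use assms(3,4,6) d(2) in simp)
qed

text \<open>A step from an even vertex raises a later coordinate and a step from an odd vertex
  lowers it, so both directions give the same edge. Adding 1 or -1 reaches every first coordinate of
  the other parity, so only the tails matter.\<close>

lemma bh_adj_if_nb:
  assumes u: "u \<in> bh_V0 (Suc m)" and v: "v \<in> bh_V1 (Suc m)" and nb: "tl v \<in> nb (tl u)"
  shows "bh_adj (Suc m) u v" "bh_adj (Suc m) v u"
proof -
  obtain a x where ax: "u = a # x" "a = 0 \<or> a = 2" "x \<in> bh_vertices m"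
    using u unfolding bh_V0_Suc by blast
  obtain b y where b_y: "v = b # y" "b = 1 \<or> b = 3" "y \<in> bh_vertices m"
    using v unfolding bh_V1_Suc by blast
  have V: "u \<in> bh_vertices (Suc m)" "v \<in> bh_vertices (Suc m)"
    using u v by (auto simp: bh_V0_def bh_V1_def)
  have d: "\<exists>d\<in>{1, -1}. b = nat ((int a + d) mod 4)" "\<exists>d\<in>{1, -1}. a = nat ((int b + d) mod 4)"
    using ax(2) b_y(2) by auto
  have sgn: "(-1::int) ^ a = 1" "(-1::int) ^ b = -1" using ax(2) b_y(2) by auto
  have len: "length x = m" "length y = m" using ax b_y by (auto simp: bh_vertices_def)
  from nb_cases[OF nb] consider "y = x" | i where "i < m" "y = x[i := (x ! i + 1) mod 4]"
    using ax b_y len by auto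
  then have "bh_adj (Suc m) u v \<and> bh_adj (Suc m) v u"
  proof cases
    case 1
    then show ?thesis using V d unfolding bh_adj_def ax(1) b_y(1) by auto
  next
    case 2
    have xi: "x ! i < 4" using ax(3) 2(1) by (simp add: bh_vertices_def)
    have yi: "y ! i = (x ! i + 1) mod 4" using 2 len by simp
    have "x ! i = 0 \<or> x ! i = 1 \<or> x ! i = 2 \<or> x ! i = 3" using xi by auto
    then have e: "nat ((int (x ! i) + 1) mod 4) = (x ! i + 1) mod 4"
      "nat ((int (y ! i) + -1) mod 4) = x ! i" unfolding yi by auto
    have "y = x[i := nat ((int (x ! i) + 1) mod 4)]" using 2(2) e(1) by simp
    moreover have "x = y[i := nat ((int (y ! i) + -1) mod 4)]" using 2(2) e(2) by simp
    ultimately have "b # y = (a # x)[0 := b, Suc i := nat ((int ((a # x) ! Suc i) + (-1) ^ ((a # x) ! 0)) mod 4)]"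
      "a # x = (b # y)[0 := a, Suc i := nat ((int ((b # y) ! Suc i) + (-1) ^ ((b # y) ! 0)) mod 4)]"
      using sgn by simp_all
    from bh_adjI[OF _ _ _ _ _ this(1)] bh_adjI[OF _ _ _ _ _ this(2)] show ?thesis
      using d V 2(1) ax(1) b_y(1) by simp
  qed
  then show "bh_adj (Suc m) u v" "bh_adj (Suc m) v u" by blast+
qed

section \<open>Counting, and the perfect matching that avoids the terminals\<close>

lemma card_two_Cons_images:
  assumes "finite Z" "a \<noteq> b"
  shows "card (Cons a ` Z \<union> Cons b ` Z) = 2 * card Z"
  using assms by (subst card_Un_disjoint) (auto simp: card_image inj_on_def)

lemma card_le_twice_tl_image:
  assumes "X \<subseteq> bh_V0 (Suc m)"
  shows "card X \<le> 2 * card (tl ` X)"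
proof -
  have "finite (tl ` X)"
    by (rule finite_subset[of _ "bh_vertices m"]) (use assms in \<open>auto simp: bh_V0_Suc\<close>)
  moreover have "X \<subseteq> Cons 0 ` tl ` X \<union> Cons 2 ` tl ` X"
  proof
    fix v assume v: "v \<in> X"
    then obtain x where "v = 0 # x \<or> v = 2 # x" using assms unfolding bh_V0_Suc by blast
    moreover from this have "x \<in> tl ` X" using imageI[OF v, of tl] by auto
    ultimately show "v \<in> Cons 0 ` tl ` X \<union> Cons 2 ` tl ` X" by blast
  qed
  ultimately show ?thesis
    using card_two_Cons_images[of "tl ` X" 0 2] card_mono[of "Cons 0 ` tl ` X \<union> Cons 2 ` tl ` X" X]
    by simp
qed

lemma finite_bh_V0: "finite (bh_V0 m)" and finite_bh_V1: "finite (bh_V1 m)"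
  by (auto simp: bh_V0_def bh_V1_def)

lemma card_bh_V0: "card (bh_V0 (Suc m)) = 2 * 4 ^ m"
  and card_bh_V1: "card (bh_V1 (Suc m)) = 2 * 4 ^ m"
  unfolding bh_V0_Suc bh_V1_Suc by (simp_all add: card_two_Cons_images card_bh_vertices)

text \<open>Let \<open>Y\<close> be the set of tails of \<open>X\<close>. By expansion
  \<open>X\<close> has at least \<open>2 * card Y + 2 * m\<close> odd neighbours, while
  \<open>card X \<le> 2 * card Y\<close>, so deleting \<open>T\<close> is affordable. If
  \<open>Y\<close> dominates everything, all of \<open>?B - T\<close> is available, which is as
  large as \<open>?A - S\<close>.\<close>

lemma matching_avoiding:
  assumes S: "S \<subseteq> bh_V0 (Suc m)" and T: "T \<subseteq> bh_V1 (Suc m)"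
    and card: "card S = card T" "card T \<le> 2 * m"
  shows "\<exists>r. bij_betw r (bh_V0 (Suc m) - S) (bh_V1 (Suc m) - T) \<and>
    (\<forall>a \<in> bh_V0 (Suc m) - S. tl (r a) \<in> nb (tl a))"
proof -
  let ?A = "bh_V0 (Suc m)" and ?B = "bh_V1 (Suc m)"
  let ?F = "\<lambda>a. {b \<in> ?B - T. tl b \<in> nb (tl a)}"
  have finT: "finite T" using T finite_bh_V1 finite_subset by blast
  have cards: "card (?A - S) = card (?B - T)"
    using S T card(1) finite_bh_V0 finite_bh_V1
    by (simp add: card_Diff_subset finite_subset card_bh_V0 card_bh_V1)
  have "\<exists>r. inj_on r (?A - S) \<and> (\<forall>a\<in>?A - S. r a \<in> ?F a)"
  proof (rule hall_marriage)
    fix X assume X: "X \<subseteq> ?A - S"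
    define Y where "Y = tl ` X"
    have Y: "Y \<subseteq> bh_vertices m" using X by (auto simp: Y_def bh_V0_Suc)
    have U: "\<Union>(?F ` X) = {b \<in> ?B. tl b \<in> Nb Y} - T" by (auto simp: Y_def Nb_def)
    show "card X \<le> card (\<Union>(?F ` X))"
    proof (cases "X = {} \<or> Nb Y = bh_vertices m")
      case True
      then show ?thesis
      proof
        assume full: "Nb Y = bh_vertices m"
        have "{b \<in> ?B. tl b \<in> Nb Y} = ?B" unfolding full by (auto simp: bh_V1_Suc)
        then have "card (\<Union>(?F ` X)) = card (?A - S)" unfolding U using cards by simp
        then show ?thesis using card_mono[OF _ X] finite_bh_V0 by simp
      qed simp
    next
      case False
      have fin: "finite (Nb Y)" using Nb_subset[OF Y] finite_subset finite_bh_vertices by blast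
      have "{b \<in> ?B. tl b \<in> Nb Y} = Cons 1 ` Nb Y \<union> Cons 3 ` Nb Y"
        using Nb_subset[OF Y] by (auto simp: bh_V1_Suc)
      then have "card {b \<in> ?B. tl b \<in> Nb Y} = 2 * card (Nb Y)"
        using card_two_Cons_images[OF fin, of 1 3] by simp
      moreover have "card Y + m \<le> card (Nb Y)"
        using False by (intro card_Nb_ge Y) (auto simp: Y_def)
      moreover have "card X \<le> 2 * card Y"
        unfolding Y_def using X by (intro card_le_twice_tl_image) auto
      moreover have "card {b \<in> ?B. tl b \<in> Nb Y} - card T \<le> card (\<Union>(?F ` X))"
        unfolding U by (rule diff_card_le_card_Diff[OF finT])
      ultimately show ?thesis using card(2) by linarith
    qed
  qed (auto simp: finite_bh_V0 finite_bh_V1)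
  then obtain r where r: "inj_on r (?A - S)" "\<forall>a\<in>?A - S. r a \<in> ?F a" by blast
  have "r ` (?A - S) = ?B - T"
    using r cards by (intro card_subset_eq) (auto simp: finite_bh_V1 card_image)
  then show ?thesis using r unfolding bij_betw_def by blast
qed

section \<open>The initial matching and its connectivity\<close>

text \<open>The projected edges join the even \<open>x\<close> to the odd \<open>x\<close> and the
  odd \<open>nxt x\<close>; as \<open>nxt\<close> is a single cycle in positive dimension, they form
  a Hamiltonian cycle of the quotient.\<close>

definition first_match :: "nat list \<Rightarrow> nat list" where
  "first_match v = (if hd v = 0 then 1 # tl v else 3 # nxt (tl v))"

lemma bij_first_match: "bij_betw first_match (bh_V0 (Suc m)) (bh_V1 (Suc m))"
proof -
  have inj: "inj_on first_match (bh_V0 (Suc m))"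
    by (auto simp: inj_on_def first_match_def bh_V0_Suc dest: inj_onD[OF inj_on_nxt])
  have "first_match ` bh_V0 (Suc m) \<subseteq> bh_V1 (Suc m)"
    by (auto simp: first_match_def bh_V0_Suc bh_V1_Suc nxt_in_bh_vertices)
  then have "first_match ` bh_V0 (Suc m) = bh_V1 (Suc m)"
    using inj by (intro card_subset_eq) (simp_all add: finite_bh_V1 card_image card_bh_V0 card_bh_V1)
  then show ?thesis using inj by (simp add: bij_betw_def)
qed

lemma first_match_nb:
  assumes "v \<in> bh_V0 (Suc (Suc k))"
  shows "tl (first_match v) \<in> nb (tl v)"
proof -
  have "x \<noteq> []" if "x \<in> bh_vertices (Suc k)" for x using that by (auto simp: bh_vertices_def)
  then show ?thesis using assms by (auto simp: bh_V0_Suc first_match_def self_in_nb nxt_in_nb)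
qed

text \<open>A closed set contains both even vertices over each of its tails. The partners of
  \<open>2 # x\<close> and \<open>0 # nxt x\<close> are twins, so the set of tails is closed under
  \<open>nxt\<close> and is everything.\<close>

lemma first_match_connected:
  assumes X: "X \<subseteq> bh_V0 (Suc (Suc k))" "X \<noteq> {}"
    and closed: "\<forall>a\<in>X. \<forall>a'\<in>bh_V0 (Suc (Suc k)).
      tl a = tl a' \<or> tl (first_match a) = tl (first_match a') \<longrightarrow> a' \<in> X"
  shows "X = bh_V0 (Suc (Suc k))"
proof -
  let ?Q = "bh_vertices (Suc k)"
  define Y where "Y = tl ` X"
  have YQ: "Y \<subseteq> ?Q" using X(1) by (auto simp: Y_def bh_V0_Suc)
  have fibre: "0 # x \<in> X \<and> 2 # x \<in> X" if x: "x \<in> Y" for x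
  proof -
    obtain v where v: "v \<in> X" "x = tl v" using x by (auto simp: Y_def)
    have "0 # x \<in> bh_V0 (Suc (Suc k))" "2 # x \<in> bh_V0 (Suc (Suc k))"
      using x YQ by (auto simp: bh_V0_Suc)
    then show ?thesis using closed v by (metis list.sel(3))
  qed
  have "nxt x \<in> Y" if x: "x \<in> Y" for x
  proof -
    have "0 # nxt x \<in> bh_V0 (Suc (Suc k))"
      using x YQ nxt_in_bh_vertices by (auto simp: bh_V0_Suc)
    moreover have "tl (first_match (2 # x)) = tl (first_match (0 # nxt x))"
      by (simp add: first_match_def)
    ultimately have "0 # nxt x \<in> X" using closed fibre[OF x] by blast
    then show ?thesis unfolding Y_def by force
  qed
  then have "Y = ?Q" using YQ X(2) by (intro nxt_transitive) (auto simp: Y_def)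
  then show ?thesis using fibre X(1) by (auto simp: bh_V0_Suc)
qed

section \<open>Assembling the path cover\<close>

theorem theorem8:
  fixes n :: nat and s t :: "nat \<Rightarrow> nat list"
  assumes "n \<ge> 2"
    and "inj_on s {..<2*n-2}" and "s ` {..<2*n-2} \<subseteq> bh_V0 n"
    and "inj_on t {..<2*n-2}" and "t ` {..<2*n-2} \<subseteq> bh_V1 n"
  shows "\<exists>(\<psi>::nat \<Rightarrow> nat) (P::nat \<Rightarrow> nat list list).
           bij_betw \<psi> {..<2*n-2} {..<2*n-2} \<and>
           (\<forall>i<2*n-2. bh_path n (P i) \<and> hd (P i) = s i \<and> last (P i) = t (\<psi> i)) \<and>
           (\<forall>i<2*n-2. \<forall>j<2*n-2. i \<noteq> j \<longrightarrow> set (P i) \<inter> set (P j) = {}) \<and>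
           (\<Union>i<2*n-2. set (P i)) = bh_vertices n"
proof -
  \<comment> \<open>The quotient has dimension \<open>Suc k\<close>, positive as the Hamiltonian
    cycle requires, and \<open>2 * n - 2 = 2 * Suc k\<close> is exactly the bound in
    \<open>matching_avoiding\<close>.\<close>
  obtain k where n: "n = Suc (Suc k)" using assms(1) by (metis Suc_le_D numeral_2_eq_2 Suc_le_mono)
  define I where "I = {..<2 * n - 2}"
  let ?A = "bh_V0 n" and ?B = "bh_V1 n"
  define S where "S = s ` I"
  define T where "T = t ` I"
  have inj: "inj_on s I" "inj_on t I" using assms by (simp_all add: I_def)
  have S: "S \<subseteq> ?A" and T: "T \<subseteq> ?B" using assms by (simp_all add: S_def T_def I_def)
  have cardST: "card S = 2 * Suc k" "card T = 2 * Suc k"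
    using inj by (simp_all add: S_def T_def card_image I_def n)
  have fin: "finite S" "finite T" by (simp_all add: S_def T_def I_def)
  have s0: "s 0 \<in> S" by (simp add: S_def I_def n)
  have disj: "?A \<inter> ?B = {}" by (auto simp: bh_V0_def bh_V1_def)
  have AB: "?A \<union> ?B = bh_vertices n" by (auto simp: bh_V0_def bh_V1_def)
  obtain r where r: "bij_betw r (?A - S) (?B - T)" "\<forall>a \<in> ?A - S. tl (r a) \<in> nb (tl a)"
    using matching_avoiding[of S "Suc k" T] S T cardST unfolding n by auto
  obtain q where q: "bij_betw q S T"
    using fin cardST finite_same_card_bij by metis
  \<comment> \<open>The pairs given by \<open>q\<close> need not be edges: they only complete the
    bijection, and cutting removes them.\<close>
  define r' where "r' = (\<lambda>a. if a \<in> S then q a else r a)"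
  have r'S: "bij_betw r' S T" using q by (rule bij_betw_cong[THEN iffD1, rotated]) (simp add: r'_def)
  have r'A: "bij_betw r' (?A - S) (?B - T)"
    using r(1) by (rule bij_betw_cong[THEN iffD1, rotated]) (simp add: r'_def)
  have "bij_betw r' (S \<union> (?A - S)) (T \<union> (?B - T))"
    using r'S r'A by (rule bij_betw_combine) blast
  then have r': "bij_betw r' ?A ?B" using S T by (simp add: Un_absorb1)
  define g where "g = inv_into ?A r'"
  have g: "bij_betw g ?B ?A" unfolding g_def using r' by (rule bij_betw_inv_into)
  have gr: "g (r' a) = a" if "a \<in> ?A" for a
    unfolding g_def using r' that by (simp add: bij_betw_inv_into_left)
  have gT: "g ` T = S"
  proof -
    have "T = r' ` S" using r'S by (simp add: bij_betw_def)
    then show ?thesis using gr S by (force simp: image_image)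
  qed
  have g_nb: "tl b \<in> nb (tl (g b))" if b: "b \<in> ?B - T" for b
  proof -
    have "r' ` (?A - S) = ?B - T" using r'A by (simp add: bij_betw_def)
    then obtain a where "a \<in> ?A - S" "b = r' a" using b by blast
    then show ?thesis using gr[of a] r(2) by (auto simp: r'_def)
  qed
  obtain f where f: "bij_betw f ?A ?B" "\<forall>a\<in>?A. tl (f a) \<in> nb (tl a)"
    "orb ?A (g \<circ> f) (s 0) = ?A"
  proof -
    have "\<exists>f. bij_betw f ?A ?B \<and> (\<forall>a\<in>?A. tl (f a) \<in> nb (tl a)) \<and> orb ?A (g \<circ> f) (s 0) = ?A"
    proof (rule single_orbit_by_twin_swaps[where p = tl and E = "\<lambda>x y. y \<in> nb x" and ?f0.0 = first_match])
      show "bij_betw first_match ?A ?B" unfolding n by (rule bij_first_match)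
      show "\<forall>a\<in>?A. tl (first_match a) \<in> nb (tl a)" unfolding n using first_match_nb by blast
      show "X = ?A" if "X \<subseteq> ?A" "X \<noteq> {}" "\<forall>a\<in>X. \<forall>a'\<in>?A.
          tl a = tl a' \<or> tl (first_match a) = tl (first_match a') \<longrightarrow> a' \<in> X" for X
        using that unfolding n by (rule first_match_connected)
    qed (use finite_bh_V0 g s0 S in blast)+
    then show thesis using that by blast
  qed
  obtain P where P: "\<And>v. v \<in> S \<Longrightarrow> P v \<noteq> [] \<and> hd (P v) = v \<and> last (P v) \<in> T \<and> distinct (P v) \<and>
        (\<forall>j. Suc j < length (P v) \<longrightarrow> (P v ! j \<in> ?A \<and> P v ! Suc j = f (P v ! j)) \<or>
            (P v ! j \<in> ?B - T \<and> P v ! Suc j = g (P v ! j)))"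
    and Pdisj: "\<And>v w. v \<in> S \<Longrightarrow> w \<in> S \<Longrightarrow> v \<noteq> w \<Longrightarrow> set (P v) \<inter> set (P w) = {}"
    and Pcover: "(\<Union>v\<in>S. set (P v)) = ?A \<union> ?B"
  proof -
    from cut_single_orbit[OF finite_bh_V0 f(1) g disj S T gT s0 f(3)]
    show thesis by (elim exE conjE) (rule that, auto)
  qed
  \<comment> \<open>The paths apply \<open>g\<close> only off \<open>T\<close>, where it follows the
    avoiding matching backwards along edges.\<close>
  have adj: "bh_adj n (P v ! j) (P v ! Suc j)" if "v \<in> S" "Suc j < length (P v)" for v j
  proof -
    from P[OF that(1)] that(2) consider
        "P v ! j \<in> ?A" "P v ! Suc j = f (P v ! j)" | "P v ! j \<in> ?B - T" "P v ! Suc j = g (P v ! j)"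
      by blast
    then show ?thesis
    proof cases
      case 1
      then show ?thesis using f(1,2) bh_adj_if_nb(1)[of _ "Suc k"] unfolding n
        by (metis bij_betwE)
    next
      case 2
      then show ?thesis using g g_nb bh_adj_if_nb(2)[of _ "Suc k"] unfolding n
        by (metis DiffD1 bij_betwE)
    qed
  qed
  have path: "bh_path n (P v)" if "v \<in> S" for v
    unfolding bh_path_def using P[OF that] adj[OF that] Pcover AB that by blast
  have sI: "s i \<in> S" if "i \<in> I" for i using that by (simp add: S_def)
  define \<psi> where "\<psi> i = inv_into I t (last (P (s i)))" for i
  have lastT: "last (P (s i)) \<in> t ` I" if "i \<in> I" for i
    using P[OF sI[OF that]] by (simp add: T_def)
  have \<psi>: "t (\<psi> i) = last (P (s i))" "\<psi> i \<in> I" if "i \<in> I" for i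
    using lastT[OF that] by (simp_all add: \<psi>_def f_inv_into_f inv_into_into)
  \<comment> \<open>Equal values would give two paths a common endpoint, against disjointness;
    finiteness then yields a permutation.\<close>
  have "inj_on \<psi> I"
  proof (rule inj_onI)
    fix i j assume ij: "i \<in> I" "j \<in> I" "\<psi> i = \<psi> j"
    then have "last (P (s i)) = last (P (s j))" using \<psi>(1) by metis
    then have "set (P (s i)) \<inter> set (P (s j)) \<noteq> {}"
      using P[OF sI[OF ij(1)]] P[OF sI[OF ij(2)]] last_in_set by (metis disjoint_iff)
    then have "s i = s j" using Pdisj sI ij by blast
    then show "i = j" using inj ij by (metis inj_onD)
  qed
  then have "bij_betw \<psi> I I"
    unfolding bij_betw_def using \<psi>(2)
    by (metis I_def endo_inj_surj finite_lessThan image_subsetI)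
  moreover have "\<forall>i\<in>I. bh_path n (P (s i)) \<and> hd (P (s i)) = s i \<and> last (P (s i)) = t (\<psi> i)"
    using path P \<psi> sI by simp
  moreover have "\<forall>i\<in>I. \<forall>j\<in>I. i \<noteq> j \<longrightarrow> set (P (s i)) \<inter> set (P (s j)) = {}"
    using Pdisj sI inj(1) by (metis inj_onD)
  moreover have "(\<Union>i\<in>I. set (P (s i))) = bh_vertices n"
    using Pcover AB by (simp add: S_def)
  ultimately show ?thesis
    unfolding I_def by (intro exI[of _ \<psi>] exI[of _ "\<lambda>i. P (s i)"]) (simp only: lessThan_iff Ball_def)
qed

end
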